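(* For $N=4$ and for $N=5$, the quantum configuration whose observables are all the points of $W_N$ and whose contexts are all the totally isotropic subspaces of $W_N$ of (projective) dimension $2$ (planes) is non-contextual.
   Context: $W_N=\mathcal{W}(2N-1,2)$ is the symplectic polar space on $\mathbb{F}_2^{2N}$ with symplectic form $\langle x|y\rangle=\sum_{i=1}^N (x_iy_{N+i}+x_{N+i}y_i)$. Its points are the nonzero vectors of $\mathbb{F}_2^{2N}$. A totally isotropic subspace of $W_N$ of (projective) dimension $k$ is a vector subspace of $\mathbb{F}_2^{2N}$ of dimension $k+1$ on which the form vanishes identically, with its zero vector removed. Let $I$ be the $2\times2$ identity matrix and $X=\begin{pmatrix}0&1\\1&0\end{pmatrix}$, $Y=\begin{pmatrix}0&-\mathrm{i}\\ \mathrm{i}&0\end{pmatrix}$, $Z=\begin{pmatrix}1&0\\0&-1\end{pmatrix}$. A point $(g_1,\dots,g_{2N})$ is identified with the (phase-free) $N$-qubit observable $G_1\otimes\cdots\otimes G_N$, $G_j\in\{I,X,Y,Z\}$, where $(g_j,g_{j+N})=(0,0),(0,1),(1,1),(1,0)$ corresponds to $G_j=I,X,Y,Z$ respectively. Two observables commute iff their vectors are orthogonal for the symplectic form. A quantum configuration is a pair $(O,C)$, with $O$ a finite set of observables and $C$ a finite set of subsets of $O$ (contexts), such that each $M\in O$ satisfies $M^2=I^{\otimes N}$, observables in the same context commute, and the matrix product of all observables of each context is $I^{\otimes N}$ (positive context) or $-I^{\otimes N}$ (negative context). Its incidence matrix $A\in\mathbb{F}_2^{|C|\times|O|}$ has $A_{i,j}=1$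 iff the $i$-th context contains the $j$-th observable; its valuation vector $E\in\mathbb{F}_2^{|C|}$ has $E_i=0$ if the $i$-th context is positive and $E_i=1$ if it is negative. The configuration is contextual iff $Ax=E$ has no solution $x\in\mathbb{F}_2^{|O|}$, and non-contextual otherwise. *)

theory Defs
  imports "Jordan_Normal_Form.VS_Connect" "HOL-Library.Z2"
begin

text \<open>
  The field with two elements is the type \<^typ>\<open>bit\<close>, and coordinates are numbered from 0.
  So the coordinates $x_i$ and $x_{N+i}$ of the usual notation are \<^term>\<open>x $ (i - 1)\<close> and
  \<^term>\<open>x $ (N + i - 1)\<close>.
\<close>

definition symplectic_form :: "nat \<Rightarrow> bit vec \<Rightarrow> bit vec \<Rightarrow> bit" where
  "symplectic_form N x y = (\<Sum>i<N. x $ i * y $ (N + i) + x $ (N + i) * y $ i)"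

definition points :: "nat \<Rightarrow> bit vec set" where
  "points N = carrier_vec (2 * N) - {0\<^sub>v (2 * N)}"

definition totally_isotropic :: "nat \<Rightarrow> nat \<Rightarrow> bit vec set \<Rightarrow> bool" where
  "totally_isotropic N k S \<longleftrightarrow>
     (\<exists>W. subspace class_ring W (module_vec TYPE(bit) (2 * N)) \<and>
          vectorspace.dim class_ring ((module_vec TYPE(bit) (2 * N)) \<lparr>carrier := W\<rparr>) = k + 1 \<and>
          (\<forall>x\<in>W. \<forall>y\<in>W. symplectic_form N x y = 0) \<and>
          S = W - {0\<^sub>v (2 * N)})"

definition pauli_I :: "complex mat" where
  "pauli_I = 1\<^sub>m 2"

definition pauli_X :: "complex mat" where
  "pauli_X = mat_of_rows_list 2 [[0, 1], [1, 0]]"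

definition pauli_Y :: "complex mat" where
  "pauli_Y = mat_of_rows_list 2 [[0, - \<i>], [\<i>, 0]]"

definition pauli_Z :: "complex mat" where
  "pauli_Z = mat_of_rows_list 2 [[1, 0], [0, -1]]"

definition pauli :: "bit \<Rightarrow> bit \<Rightarrow> complex mat" where
  "pauli a b =
     (if a = 0 then (if b = 0 then pauli_I else pauli_X)
      else (if b = 0 then pauli_Z else pauli_Y))"

definition kronecker :: "complex mat \<Rightarrow> complex mat \<Rightarrow> complex mat" (infixr \<open>\<otimes>\<^sub>K\<close> 70) where
  "A \<otimes>\<^sub>K B =
     mat (dim_row A * dim_row B) (dim_col A * dim_col B)
       (\<lambda>(i, j). A $$ (i div dim_row B, j div dim_col B) * B $$ (i mod dim_row B, j mod dim_col B))"

definition kronecker_list :: "complex mat list \<Rightarrow> complex mat" where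
  "kronecker_list Gs = foldr (\<otimes>\<^sub>K) Gs (1\<^sub>m 1)"

definition pauli_observables :: "nat \<Rightarrow> complex mat set" where
  "pauli_observables N =
     {kronecker_list Gs | Gs. length Gs = N \<and> set Gs \<subseteq> {pauli_I, pauli_X, pauli_Y, pauli_Z}}"

definition observable_of :: "nat \<Rightarrow> bit vec \<Rightarrow> complex mat" where
  "observable_of N g = kronecker_list (map (\<lambda>j. pauli (g $ j) (g $ (j + N))) [0..<N])"

text \<open>
  The factors of a context form a finite set of commuting matrices.  Their product is expressed
  by letting the factors be multiplied in every possible order, each exactly once.
\<close>

definition has_product :: "nat \<Rightarrow> complex mat set \<Rightarrow> complex mat \<Rightarrow> bool" where
  "has_product N c P \<longleftrightarrow> finite c \<and>
     (\<forall>Ms. distinct Ms \<and> set Ms = c \<longrightarrow> foldr (*) Ms (1\<^sub>m (2 ^ N)) = P)"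

definition positive_context :: "nat \<Rightarrow> complex mat set \<Rightarrow> bool" where
  "positive_context N c \<longleftrightarrow> has_product N c (1\<^sub>m (2 ^ N))"

definition negative_context :: "nat \<Rightarrow> complex mat set \<Rightarrow> bool" where
  "negative_context N c \<longleftrightarrow> has_product N c (- 1\<^sub>m (2 ^ N))"

type_synonym configuration = "complex mat set \<times> complex mat set set"

fun quantum_configuration :: "nat \<Rightarrow> configuration \<Rightarrow> bool" where
  "quantum_configuration N (Obs, Ctx) \<longleftrightarrow>
     finite Obs \<and> Obs \<subseteq> pauli_observables N \<and>
     finite Ctx \<and> (\<forall>c\<in>Ctx. c \<subseteq> Obs) \<and>
     (\<forall>M\<in>Obs. M * M = 1\<^sub>m (2 ^ N)) \<and>
     (\<forall>c\<in>Ctx. \<forall>A\<in>c. \<forall>B\<in>c. A * B = B * A) \<and>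
     (\<forall>c\<in>Ctx. positive_context N c \<or> negative_context N c)"

text \<open>
  The rows of the incidence matrix are indexed by the contexts and its columns by the observables
  themselves, so that no enumeration of them has to be chosen.
\<close>

definition incidence :: "complex mat set \<Rightarrow> complex mat \<Rightarrow> bit" where
  "incidence c M = (if M \<in> c then 1 else 0)"

definition valuation :: "nat \<Rightarrow> complex mat set \<Rightarrow> bit" where
  "valuation N c = (if negative_context N c then 1 else 0)"

fun contextual :: "nat \<Rightarrow> configuration \<Rightarrow> bool" where
  "contextual N (Obs, Ctx) \<longleftrightarrow>
     \<not> (\<exists>x :: complex mat \<Rightarrow> bit.
          \<forall>c\<in>Ctx. (\<Sum>M\<in>Obs. incidence c M * x M) = valuation N c)"

definition isotropic_configuration :: "nat \<Rightarrow> nat \<Rightarrow> configuration" where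
  "isotropic_configuration N k =
     (observable_of N ` points N, {observable_of N ` S | S. totally_isotropic N k S})"

end

theory Submission
  imports Defs "HOL-Library.Product_Plus"
begin

text \<open>
  Write $T_u$ for the observable of a point $u = (z, x)$, $\beta(u, v) = \sum_j z_j(u) x_j(v)$ and
  $q(u)$ for the number of factors $Y$ of $T_u$.  Since $Y = \mathrm{i} X Z$, we have
  $T_u T_v = \mathrm{i}^{q(u) + q(v) - q(u + v) + 2 \beta(u, v)} T_{u + v}$.  Moreover $q$ reduces to
  $\beta(u, u)$ modulo 2, and this is linear on a totally isotropic subspace $W$.  Hence with
  $f(u) = \lfloor q(u) / 2 \rfloor$ the exponent becomes, for $u, v \in W$, twice
  $f(u) + f(v) + f(u + v) + g(u, v)$, where $g(u, v) = \beta(u, v) + \beta(u, u) \beta(v, v)$ is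
  bilinear and alternating on $W$ and so is the polarization of some quadratic form $r$.  Therefore
  $u \mapsto (-1)^{f(u) + r(u)} T_u$ is multiplicative on $W$, and the product of the observables
  of a plane has sign $\sum_{u \in W} (f(u) + r(u))$.  Each monomial of $r$ takes the value 1 at
  exactly two points of a plane, so $r$ contributes nothing and $x = f$ solves $Ax = E$, for every $N$.
\<close>

section \<open>Kronecker products of matrices\<close>

lemma sum_div_mod:
  fixes f :: "nat \<Rightarrow> nat \<Rightarrow> 'a::comm_monoid_add"
  shows "(\<Sum>k = 0..<m * n. f (k div n) (k mod n)) = (\<Sum>i = 0..<m. \<Sum>j = 0..<n. f i j)"
proof -
  have "i * n + j < m * n" if "i < m" "j < n" for i j
    using that mult_le_mono1[of "Suc i" m n] by simp
  moreover have "k div n < m" "k mod n < n" if "k < m * n" for k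
    using that by (cases "n = 0"; simp add: less_mult_imp_div_less)+
  ultimately show ?thesis
    unfolding sum.cartesian_product
    by (intro sum.reindex_bij_witness[of _ "\<lambda>(i, j). i * n + j" "\<lambda>k. (k div n, k mod n)"]) auto
qed

lemma kronecker_carrier [simp]:
  assumes "A \<in> carrier_mat m n" "B \<in> carrier_mat p q"
  shows "A \<otimes>\<^sub>K B \<in> carrier_mat (m * p) (n * q)"
  using assms by (auto simp: kronecker_def)

text \<open>The inner summation index \<open>k\<close> stands for the pair
  \<open>(k div q, k mod q)\<close>; over such pairs the sum factors into one sum for
  \<open>A * C\<close> and one for \<open>B * D\<close>.\<close>

lemma kronecker_mult:
  assumes A: "A \<in> carrier_mat m n" and B: "B \<in> carrier_mat p q"
    and C: "C \<in> carrier_mat n r" and D: "D \<in> carrier_mat q s"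
  shows "(A \<otimes>\<^sub>K B) * (C \<otimes>\<^sub>K D) = (A * C) \<otimes>\<^sub>K (B * D)"
proof (rule eq_matI)
  fix i j
  assume "i < dim_row ((A * C) \<otimes>\<^sub>K (B * D))" "j < dim_col ((A * C) \<otimes>\<^sub>K (B * D))"
  with assms have ij: "i < m * p" "j < r * s"
    by (auto simp: kronecker_def)
  then have "p > 0" "s > 0"
    by (auto intro: gr0I)
  with ij have b: "i div p < m" "i mod p < p" "j div s < r" "j mod s < s"
    by (auto simp: less_mult_imp_div_less)
  have "((A \<otimes>\<^sub>K B) * (C \<otimes>\<^sub>K D)) $$ (i, j) =
      (\<Sum>k = 0..<n * q. (A $$ (i div p, k div q) * B $$ (i mod p, k mod q)) *
        (C $$ (k div q, j div s) * D $$ (k mod q, j mod s)))"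
    using assms ij by (simp add: kronecker_def scalar_prod_def)
  also have "\<dots> = (\<Sum>k = 0..<n. \<Sum>l = 0..<q. (A $$ (i div p, k) * C $$ (k, j div s)) *
        (B $$ (i mod p, l) * D $$ (l, j mod s)))"
    by (subst sum_div_mod) (simp add: mult_ac)
  also have "\<dots> = (A * C) $$ (i div p, j div s) * (B * D) $$ (i mod p, j mod s)"
    using assms b by (simp add: scalar_prod_def sum_product)
  also have "\<dots> = ((A * C) \<otimes>\<^sub>K (B * D)) $$ (i, j)"
    using assms ij by (simp add: kronecker_def)
  finally show "((A \<otimes>\<^sub>K B) * (C \<otimes>\<^sub>K D)) $$ (i, j) = ((A * C) \<otimes>\<^sub>K (B * D)) $$ (i, j)" .
qed (use assms in \<open>auto simp: kronecker_def\<close>)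

lemma kronecker_smult: "(c \<cdot>\<^sub>m A) \<otimes>\<^sub>K (d \<cdot>\<^sub>m B) = (c * d) \<cdot>\<^sub>m (A \<otimes>\<^sub>K B)"
proof (rule eq_matI)
  fix i j
  assume "i < dim_row ((c * d) \<cdot>\<^sub>m (A \<otimes>\<^sub>K B))" "j < dim_col ((c * d) \<cdot>\<^sub>m (A \<otimes>\<^sub>K B))"
  then have ij: "i < dim_row A * dim_row B" "j < dim_col A * dim_col B"
    by (auto simp: kronecker_def)
  then have "dim_row B > 0" "dim_col B > 0"
    by (auto intro: gr0I)
  with ij show "((c \<cdot>\<^sub>m A) \<otimes>\<^sub>K (d \<cdot>\<^sub>m B)) $$ (i, j) = ((c * d) \<cdot>\<^sub>m (A \<otimes>\<^sub>K B)) $$ (i, j)"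
    by (simp add: kronecker_def less_mult_imp_div_less)
qed (auto simp: kronecker_def)

lemma kronecker_one: "1\<^sub>m m \<otimes>\<^sub>K 1\<^sub>m n = 1\<^sub>m (m * n)"
proof (rule eq_matI)
  fix i j
  assume "i < dim_row (1\<^sub>m (m * n) :: complex mat)" "j < dim_col (1\<^sub>m (m * n) :: complex mat)"
  then have ij: "i < m * n" "j < m * n"
    by auto
  then have "n > 0"
    by (auto intro: gr0I)
  moreover have "i = j \<longleftrightarrow> i div n = j div n \<and> i mod n = j mod n"
    by (metis div_mod_decomp)
  ultimately show "(1\<^sub>m m \<otimes>\<^sub>K 1\<^sub>m n) $$ (i, j) = 1\<^sub>m (m * n) $$ (i, j)"
    using ij by (auto simp: kronecker_def less_mult_imp_div_less)
qed (auto simp: kronecker_def)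

section \<open>Products of Pauli matrices and of their tensor products\<close>

lemmas pauli_defs = pauli_def pauli_I_def pauli_X_def pauli_Y_def pauli_Z_def

lemma pauli_carrier [simp]: "pauli a b \<in> carrier_mat 2 2"
  by (auto simp: pauli_defs mat_of_rows_list_def)

lemma pauli_dim [simp]: "dim_row (pauli a b) = 2" "dim_col (pauli a b) = 2"
  using pauli_carrier[of a b] by (auto simp del: pauli_carrier)

text \<open>With Y = i X Z, \<open>pauli a b\<close> is i^(a b) X^b Z^a. Moving Z^a past X^d costs
  (-1)^(a d), the summand \<open>2 * of_bit (a * d)\<close>. Division by i^((a + c)(b + d)) is
  written as multiplication by its cube, as i^4 = 1, which keeps the exponent a natural
  number.\<close>

lemma pauli_mult:
  "pauli a b * pauli c d =
     \<i> ^ (of_bit (a * b) + of_bit (c * d) + 3 * of_bit ((a + c) * (b + d)) + 2 * of_bit (a * d))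
       \<cdot>\<^sub>m pauli (a + c) (b + d)"
proof (rule eq_matI)
  fix i j
  assume "i < dim_row (\<i> ^ (of_bit (a * b) + of_bit (c * d) + 3 * of_bit ((a + c) * (b + d)) +
      2 * of_bit (a * d)) \<cdot>\<^sub>m pauli (a + c) (b + d))"
    "j < dim_col (\<i> ^ (of_bit (a * b) + of_bit (c * d) + 3 * of_bit ((a + c) * (b + d)) +
      2 * of_bit (a * d)) \<cdot>\<^sub>m pauli (a + c) (b + d))"
  then have "i = 0 \<or> i = 1" "j = 0 \<or> j = 1"
    by (auto simp: less_2_cases_iff)
  then show "(pauli a b * pauli c d) $$ (i, j) =
    (\<i> ^ (of_bit (a * b) + of_bit (c * d) + 3 * of_bit ((a + c) * (b + d)) +
      2 * of_bit (a * d)) \<cdot>\<^sub>m pauli (a + c) (b + d)) $$ (i, j)"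
    by (cases a; cases b; cases c; cases d)
      (auto simp: pauli_defs mat_of_rows_list_def scalar_prod_def numeral_2_eq_2 numeral_3_eq_3)
qed auto

lemma kronecker_list_carrier:
  assumes "set Gs \<subseteq> carrier_mat n n"
  shows "kronecker_list Gs \<in> carrier_mat (n ^ length Gs) (n ^ length Gs)"
  using assms by (induction Gs) (auto simp: kronecker_list_def)

lemma kronecker_list_replicate_one:
  "kronecker_list (replicate k (1\<^sub>m n)) = 1\<^sub>m (n ^ k)"
  by (induction k) (auto simp: kronecker_list_def kronecker_one)

text \<open>Phases are kept as powers of one base \<open>z\<close>, so that those of the tensor
  factors combine into a single exponent.\<close>

lemma kronecker_list_mult:
  assumes "\<And>j. j \<in> set js \<Longrightarrow> A j \<in> carrier_mat n n" "\<And>j. j \<in> set js \<Longrightarrow> B j \<in> carrier_mat n n"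
    "\<And>j. j \<in> set js \<Longrightarrow> C j \<in> carrier_mat n n"
    and "\<And>j. j \<in> set js \<Longrightarrow> A j * B j = z ^ e j \<cdot>\<^sub>m C j"
  shows "kronecker_list (map A js) * kronecker_list (map B js) =
    z ^ (\<Sum>j\<leftarrow>js. e j) \<cdot>\<^sub>m kronecker_list (map C js)"
  using assms
proof (induction js)
  case Nil
  then show ?case
    by (auto simp: kronecker_list_def)
next
  case (Cons j js)
  let ?K = "\<lambda>F. kronecker_list (map F js)"
  have carrier: "?K F \<in> carrier_mat (n ^ length js) (n ^ length js)"
    if "\<And>j. j \<in> set js \<Longrightarrow> F j \<in> carrier_mat n n" for F
    using kronecker_list_carrier[of "map F js" n] that by auto
  have "kronecker_list (map A (j # js)) * kronecker_list (map B (j # js)) =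
      (A j \<otimes>\<^sub>K ?K A) * (B j \<otimes>\<^sub>K ?K B)"
    by (simp add: kronecker_list_def)
  also have "\<dots> = (A j * B j) \<otimes>\<^sub>K (?K A * ?K B)"
    by (rule kronecker_mult) (use Cons.prems in \<open>auto intro!: carrier\<close>)
  also have "\<dots> = (z ^ e j \<cdot>\<^sub>m C j) \<otimes>\<^sub>K (z ^ (\<Sum>j\<leftarrow>js. e j) \<cdot>\<^sub>m ?K C)"
    using Cons by simp
  finally show ?case
    by (simp add: kronecker_smult kronecker_list_def power_add)
qed


section \<open>Signs indexed by bits, and evaluation of even powers of i\<close>

text \<open>This homomorphism from the additive group of F_2 to {1, -1} turns products of signs into
  the linear algebra in which \<open>contextual\<close> is stated.\<close>

definition bit_sign :: "bit \<Rightarrow> complex" where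
  "bit_sign b = (if b = 0 then 1 else - 1)"

lemma bit_sign_0 [simp]: "bit_sign 0 = 1" and bit_sign_1 [simp]: "bit_sign 1 = - 1"
  by (auto simp: bit_sign_def)

lemma bit_sign_add: "bit_sign (a + b) = bit_sign a * bit_sign b"
  by (cases a; cases b) auto

lemma bit_sign_of_nat: "bit_sign (of_nat n) = (- 1) ^ n"
  by (induction n) (auto simp: bit_sign_add)

lemma of_nat_of_bit [simp]: "of_nat (of_bit b) = (b :: bit)"
  by (cases b) auto

text \<open>The parity hypothesis makes the exponent even. The halves contribute signs, where 3
  counts as 1 modulo 2. What is left is i^(p0 + q0 + 3 r0) for the parities p0, q0, r0, with r0 = p0
  + q0 modulo 2; it equals -1 exactly if p0 = q0 = 1, hence the term
  \<open>of_nat p * of_nat q\<close>.\<close>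

lemma phase_eq_bit_sign:
  assumes "(of_nat r :: bit) = of_nat p + of_nat q"
  shows "\<i> ^ (p + q + 3 * r + 2 * s) =
    bit_sign (of_nat (p div 2) + of_nat (q div 2) + of_nat (r div 2) + of_nat s + of_nat p * of_nat q)"
proof -
  define p' q' r' where d: "p' = p div 2" "q' = q div 2" "r' = r div 2"
  have e: "p = 2 * p' + p mod 2" "q = 2 * q' + q mod 2" "r = 2 * r' + r mod 2"
    by (simp_all add: d)
  have m: "p mod 2 = 0 \<or> p mod 2 = 1" "q mod 2 = 0 \<or> q mod 2 = 1" "r mod 2 = 0 \<or> r mod 2 = 1"
    by auto
  have bits: "(of_nat p :: bit) = of_nat (p mod 2)" "(of_nat q :: bit) = of_nat (q mod 2)"
    "(of_nat r :: bit) = of_nat (r mod 2)"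
    by (subst e, simp)+
  have "\<i> ^ (p + q + 3 * r + 2 * s) =
      \<i> ^ (2 * (p' + q' + 3 * r' + s) + (p mod 2 + q mod 2 + 3 * (r mod 2)))"
    by (subst e(1), subst e(2), subst e(3)) (simp add: algebra_simps)
  also have "\<dots> = (- 1) ^ (p' + q' + 3 * r' + s) * \<i> ^ (p mod 2 + q mod 2 + 3 * (r mod 2))"
    by (simp add: power_add power_mult)
  also have "(- 1) ^ (p' + q' + 3 * r' + s) = bit_sign (of_nat p' + of_nat q' + of_nat r' + of_nat s)"
    by (simp only: bit_sign_add bit_sign_of_nat power_add power_mult) simp
  also have "\<i> ^ (p mod 2 + q mod 2 + 3 * (r mod 2)) = bit_sign (of_nat p * of_nat q)"
    \<comment> \<open>The instance of \<open>power_mult\<close> evaluates i^4, which is left when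
      exactly one of \<open>p\<close> and \<open>q\<close> is odd.\<close>
    using m assms power_mult[of \<i> 2 2] unfolding bits by (elim disjE) simp_all
  finally show ?thesis
    by (simp add: bit_sign_add d)
qed

section \<open>The bilinear form, the number of factors Y, and the multiplication rule for
  observables\<close>

text \<open>In the notation of the overview, \<open>half_form\<close> is \<beta>,
  \<open>y_count\<close> is q and \<open>y_half\<close> is f reduced modulo 2.\<close>

definition half_form :: "nat \<Rightarrow> bit vec \<Rightarrow> bit vec \<Rightarrow> bit" where
  "half_form N u v = (\<Sum>j<N. u $ j * v $ (j + N))"

definition y_count :: "nat \<Rightarrow> bit vec \<Rightarrow> nat" where
  "y_count N u = (\<Sum>j<N. of_bit (u $ j * u $ (j + N)))"

definition y_half :: "nat \<Rightarrow> bit vec \<Rightarrow> bit" where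
  "y_half N u = of_nat (y_count N u div 2)"

lemma of_nat_y_count: "of_nat (y_count N u) = half_form N u u"
  unfolding y_count_def half_form_def of_nat_sum of_nat_of_bit ..

lemma symplectic_form_eq: "symplectic_form N u v = half_form N u v + half_form N v u"
  unfolding symplectic_form_def half_form_def sum.distrib[symmetric]
  by (intro sum.cong) (auto simp: ac_simps)

lemma half_form_add_left:
  assumes "u \<in> carrier_vec (2 * N)" "v \<in> carrier_vec (2 * N)"
  shows "half_form N (u + v) w = half_form N u w + half_form N v w"
  unfolding half_form_def sum.distrib[symmetric]
  by (intro sum.cong) (use assms in \<open>auto simp: algebra_simps\<close>)

lemma half_form_add_right:
  assumes "u \<in> carrier_vec (2 * N)" "v \<in> carrier_vec (2 * N)"
  shows "half_form N w (u + v) = half_form N w u + half_form N w v"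
  unfolding half_form_def sum.distrib[symmetric]
  by (intro sum.cong) (use assms in \<open>auto simp: algebra_simps\<close>)

lemma half_form_smult_left:
  "u \<in> carrier_vec (2 * N) \<Longrightarrow> half_form N (t \<cdot>\<^sub>v u) w = t * half_form N u w"
  unfolding half_form_def sum_distrib_left by (intro sum.cong) (auto simp: algebra_simps)

lemma half_form_smult_right:
  "u \<in> carrier_vec (2 * N) \<Longrightarrow> half_form N w (t \<cdot>\<^sub>v u) = t * half_form N w u"
  unfolding half_form_def sum_distrib_left by (intro sum.cong) (auto simp: algebra_simps)

lemmas half_form_bilinear =
  half_form_add_left half_form_add_right half_form_smult_left half_form_smult_right

lemma observable_of_carrier [simp]: "observable_of N u \<in> carrier_mat (2 ^ N) (2 ^ N)"
  unfolding observable_of_def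
  using kronecker_list_carrier[of "map (\<lambda>j. pauli (u $ j) (u $ (j + N))) [0..<N]" 2]
  by (simp add: image_subset_iff)

lemma observable_of_zero: "observable_of N (0\<^sub>v (2 * N)) = 1\<^sub>m (2 ^ N)"
proof -
  have "map (\<lambda>j. pauli (0\<^sub>v (2 * N) $ j) (0\<^sub>v (2 * N) $ (j + N))) [0..<N] = replicate N (1\<^sub>m 2)"
    by (intro nth_equalityI) (auto simp: pauli_def pauli_I_def)
  then show ?thesis
    by (simp add: observable_of_def kronecker_list_replicate_one)
qed

lemma observable_of_mult:
  assumes "u \<in> carrier_vec (2 * N)" "v \<in> carrier_vec (2 * N)"
  shows "observable_of N u * observable_of N v =
    \<i> ^ (y_count N u + y_count N v + 3 * y_count N (u + v) +
      2 * (\<Sum>j<N. of_bit (u $ j * v $ (j + N)))) \<cdot>\<^sub>m observable_of N (u + v)"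
proof -
  define e :: "nat \<Rightarrow> nat" where "e = (\<lambda>j. of_bit (u $ j * u $ (j + N)) + of_bit (v $ j * v $ (j + N)) +
    3 * of_bit ((u + v) $ j * (u + v) $ (j + N)) + 2 * of_bit (u $ j * v $ (j + N)))"
  have "observable_of N u * observable_of N v =
      \<i> ^ (\<Sum>j\<leftarrow>[0..<N]. e j) \<cdot>\<^sub>m observable_of N (u + v)"
    unfolding observable_of_def
  proof (rule kronecker_list_mult[where n = 2])
    fix j
    assume "j \<in> set [0..<N]"
    then have "(u + v) $ j = u $ j + v $ j" "(u + v) $ (j + N) = u $ (j + N) + v $ (j + N)"
      using assms by auto
    then show "pauli (u $ j) (u $ (j + N)) * pauli (v $ j) (v $ (j + N)) =
        \<i> ^ e j \<cdot>\<^sub>m pauli ((u + v) $ j) ((u + v) $ (j + N))"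
      by (simp only: pauli_mult e_def)
  qed (rule pauli_carrier)+
  also have "(\<Sum>j\<leftarrow>[0..<N]. e j) = (\<Sum>j<N. e j)"
    by (simp only: interv_sum_list_conv_sum_set_nat set_upt atLeast0LessThan)
  also have "\<dots> = y_count N u + y_count N v + 3 * y_count N (u + v) +
      2 * (\<Sum>j<N. of_bit (u $ j * v $ (j + N)))"
    unfolding e_def y_count_def sum.distrib sum_distrib_left ..
  finally show ?thesis .
qed

text \<open>The cross terms \<beta>(u, v) + \<beta>(v, u) add up to the symplectic form and vanish.
  This supplies the parity hypothesis of \<open>phase_eq_bit_sign\<close> for the numbers of factors
  Y.\<close>

lemma half_form_diag_add:
  assumes "u \<in> carrier_vec (2 * N)" "v \<in> carrier_vec (2 * N)" "symplectic_form N u v = 0"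
  shows "half_form N (u + v) (u + v) = half_form N u u + half_form N v v"
  using assms
  by (cases "half_form N u u"; cases "half_form N v v"; cases "half_form N u v"; cases "half_form N v u")
    (simp_all add: symplectic_form_eq half_form_bilinear)

lemma observable_of_mult_isotropic:
  assumes "u \<in> carrier_vec (2 * N)" "v \<in> carrier_vec (2 * N)" "symplectic_form N u v = 0"
  shows "observable_of N u * observable_of N v =
    bit_sign (y_half N u + y_half N v + y_half N (u + v) + half_form N u v +
      half_form N u u * half_form N v v) \<cdot>\<^sub>m observable_of N (u + v)"
proof -
  have "(of_nat (\<Sum>j<N. of_bit (u $ j * v $ (j + N))) :: bit) = half_form N u v"
    unfolding half_form_def of_nat_sum of_nat_of_bit ..
  then show ?thesis
    using observable_of_mult[OF assms(1,2)] half_form_diag_add[OF assms]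
    by (simp add: phase_eq_bit_sign of_nat_y_count y_half_def)
qed

lemma smult_smult_mat: "a \<cdot>\<^sub>m (b \<cdot>\<^sub>m A) = (a * b :: 'a :: semigroup_mult) \<cdot>\<^sub>m A"
  by (rule eq_matI) (auto simp: mult.assoc)

lemma one_smult_mat: "(1 :: 'a :: monoid_mult) \<cdot>\<^sub>m A = A"
  by (rule eq_matI) auto

text \<open>In the phase of \<open>observable_of_mult\<close> everything but 2 \<beta>(u, v) is
  symmetric in u and v, so exchanging the factors changes the exponent of -1 by \<beta>(u, v) +
  \<beta>(v, u).\<close>

lemma observable_of_commute:
  assumes "u \<in> carrier_vec (2 * N)" "v \<in> carrier_vec (2 * N)"
  shows "observable_of N u * observable_of N v =
    bit_sign (symplectic_form N u v) \<cdot>\<^sub>m (observable_of N v * observable_of N u)"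
proof -
  have half: "\<i> ^ (2 * (\<Sum>j<N. of_bit (u $ j * v $ (j + N)))) = bit_sign (half_form N u v)" for u v :: "bit vec"
  proof -
    have "(of_nat (\<Sum>j<N. of_bit (u $ j * v $ (j + N))) :: bit) = half_form N u v"
      unfolding half_form_def of_nat_sum of_nat_of_bit ..
    moreover have "\<i> ^ (2 * n) = bit_sign (of_nat n)" for n
      by (simp add: bit_sign_of_nat power_mult)
    ultimately show ?thesis
      by (simp only:)
  qed
  have mult: "observable_of N u * observable_of N v =
      (\<i> ^ (y_count N u + y_count N v + 3 * y_count N (u + v)) * bit_sign (half_form N u v))
        \<cdot>\<^sub>m observable_of N (u + v)"
    if "u \<in> carrier_vec (2 * N)" "v \<in> carrier_vec (2 * N)" for u v
    unfolding observable_of_mult[OF that] by (simp only: power_add half)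
  have "v + u = u + v"
    using assms by (rule comm_add_vec[rotated])
  moreover have "bit_sign (half_form N u v) =
      bit_sign (symplectic_form N u v) * bit_sign (half_form N v u)"
    by (cases "half_form N u v"; cases "half_form N v u") (simp_all add: symplectic_form_eq)
  ultimately show ?thesis
    unfolding mult[OF assms] mult[OF assms(2,1)] smult_smult_mat
    by (simp only: mult_ac add.commute)
qed

lemma observable_of_square:
  assumes "u \<in> carrier_vec (2 * N)"
  shows "observable_of N u * observable_of N u = 1\<^sub>m (2 ^ N)"
proof -
  have "u + u = 0\<^sub>v (2 * N)"
    using assms by (intro eq_vecI) auto
  moreover have "y_half N (0\<^sub>v (2 * N)) = 0"
    by (simp add: y_half_def y_count_def)
  moreover have "symplectic_form N u u = 0"
    by (simp add: symplectic_form_eq)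
  ultimately show ?thesis
    using observable_of_mult_isotropic[OF assms assms]
    by (simp add: observable_of_zero one_smult_mat)
qed


section \<open>Nondegeneracy of the form and injectivity of the map from vectors to
  observables\<close>

lemma symplectic_form_unit_vec:
  assumes "i < N"
  shows "symplectic_form N u (unit_vec (2 * N) (N + i)) = u $ i"
    and "symplectic_form N u (unit_vec (2 * N) i) = u $ (N + i)"
proof -
  have "symplectic_form N u (unit_vec (2 * N) (N + i)) = (\<Sum>k<N. if k = i then u $ i else 0)"
    unfolding symplectic_form_def using assms by (intro sum.cong) auto
  then show "symplectic_form N u (unit_vec (2 * N) (N + i)) = u $ i"
    using assms by simp
  have "symplectic_form N u (unit_vec (2 * N) i) = (\<Sum>k<N. if k = i then u $ (N + i) else 0)"
    unfolding symplectic_form_def using assms by (intro sum.cong) auto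
  then show "symplectic_form N u (unit_vec (2 * N) i) = u $ (N + i)"
    using assms by simp
qed

text \<open>Pairing with the unit vector of the conjugate coordinate, at distance \<open>N\<close>,
  reads off each coordinate.\<close>

lemma symplectic_form_nondegenerate:
  assumes "u \<in> carrier_vec (2 * N)" "v \<in> carrier_vec (2 * N)"
    and eq: "\<And>z. z \<in> carrier_vec (2 * N) \<Longrightarrow> symplectic_form N u z = symplectic_form N v z"
  shows "u = v"
proof (rule eq_vecI)
  fix i
  assume "i < dim_vec v"
  then have i: "i < 2 * N"
    using assms by auto
  show "u $ i = v $ i"
  proof (cases "i < N")
    case True
    then show ?thesis
      using eq[of "unit_vec (2 * N) (N + i)"] by (simp add: symplectic_form_unit_vec)
  next
    case False
    then show ?thesis
      using i eq[of "unit_vec (2 * N) (i - N)"]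
        symplectic_form_unit_vec(2)[of "i - N" N u] symplectic_form_unit_vec(2)[of "i - N" N v]
      by simp
  qed
qed (use assms in auto)

text \<open>An observable determines its commutation signs with all T_z, hence the values of the
  symplectic form against all z, hence its vector.\<close>

lemma observable_of_inj: "inj_on (observable_of N) (carrier_vec (2 * N))"
proof (rule inj_onI)
  fix u v
  assume u: "u \<in> carrier_vec (2 * N)" and v: "v \<in> carrier_vec (2 * N)"
    and eq: "observable_of N u = observable_of N v"
  show "u = v"
  proof (rule symplectic_form_nondegenerate[OF u v])
    fix z :: "bit vec"
    assume z: "z \<in> carrier_vec (2 * N)"
    define P where "P = observable_of N z * observable_of N u"
    have P: "P \<in> carrier_mat (2 ^ N) (2 ^ N)"
      unfolding P_def by (rule mult_carrier_mat[OF observable_of_carrier observable_of_carrier])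
    \<comment> \<open>T_u and T_z are involutions, so the reversed product inverts
      \<open>P\<close>.\<close>
    have PP: "P * (observable_of N u * observable_of N z) = 1\<^sub>m (2 ^ N)"
    proof -
      have "P * (observable_of N u * observable_of N z) =
          observable_of N z * (observable_of N u * observable_of N u * observable_of N z)"
        unfolding P_def
        by (simp add: assoc_mult_mat[where n\<^sub>1 = "2 ^ N" and n\<^sub>2 = "2 ^ N" and n\<^sub>3 = "2 ^ N" and n\<^sub>4 = "2 ^ N"]
            mult_carrier_mat[OF observable_of_carrier observable_of_carrier])
      then show ?thesis
        by (simp add: observable_of_square u z left_mult_one_mat[OF observable_of_carrier])
    qed
    have "bit_sign (symplectic_form N u z) \<cdot>\<^sub>m P = bit_sign (symplectic_form N v z) \<cdot>\<^sub>m P"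
      using observable_of_commute[OF u z] observable_of_commute[OF v z] eq by (simp add: P_def)
    then have entry: "bit_sign (symplectic_form N u z) * P $$ (i, j) = bit_sign (symplectic_form N v z) * P $$ (i, j)"
      if "i < 2 ^ N" "j < 2 ^ N" for i j
      using P that by (metis carrier_matD index_smult_mat(1))
    \<comment> \<open>\<open>P\<close> is invertible, so the two commutation signs with \<open>T_z\<close> cannot differ.\<close>
    show "symplectic_form N u z = symplectic_form N v z"
    proof (rule ccontr)
      assume ne: "symplectic_form N u z \<noteq> symplectic_form N v z"
      have "P $$ (i, j) = 0" if "i < 2 ^ N" "j < 2 ^ N" for i j
        using entry[OF that] ne by (auto simp: bit_sign_def split: if_splits)
      then have "P = 0\<^sub>m (2 ^ N) (2 ^ N)"
        using P by (intro eq_matI) auto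
      then have "1\<^sub>m (2 ^ N) = (0\<^sub>m (2 ^ N) (2 ^ N) :: complex mat)"
        using PP left_mult_zero_mat[OF mult_carrier_mat[OF observable_of_carrier observable_of_carrier]]
        by metis
      then have "(1\<^sub>m (2 ^ N) :: complex mat) $$ (0, 0) = 0\<^sub>m (2 ^ N) (2 ^ N) $$ (0, 0)"
        by (rule arg_cong)
      then show False
        by simp
    qed
  qed
qed

section \<open>Ordered products of matrices that multiply up to a sign\<close>

text \<open>
  The hypothesis says that $t \mapsto (-1)^{\sigma(t)} M_t$ is multiplicative, so every order of the
  factors gives the same sign.
\<close>

lemma foldr_mult_twisted:
  fixes M :: "'a :: comm_monoid_add \<Rightarrow> complex mat"
  assumes "\<And>t. M t \<in> carrier_mat n n" "M 0 = 1\<^sub>m n" "\<sigma> 0 = 0"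
    and mult: "\<And>s t. M s * M t = bit_sign (\<sigma> s + \<sigma> t + \<sigma> (s + t)) \<cdot>\<^sub>m M (s + t)"
  shows "foldr (*) (map M ts) (1\<^sub>m n) =
    bit_sign ((\<Sum>t\<leftarrow>ts. \<sigma> t) + \<sigma> (sum_list ts)) \<cdot>\<^sub>m M (sum_list ts)"
proof (induction ts)
  case Nil
  then show ?case
    using assms by (simp add: one_smult_mat)
next
  case (Cons t ts)
  define p q where "p = (\<Sum>t\<leftarrow>ts. \<sigma> t)" and "q = sum_list ts"
  \<comment> \<open>The intermediate value \<open>\<sigma> q\<close> occurs twice and
    cancels.\<close>
  have "bit_sign (p + \<sigma> q) * bit_sign (\<sigma> t + \<sigma> q + \<sigma> (t + q)) = bit_sign (\<sigma> t + p + \<sigma> (t + q))"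
    by (cases p; cases "\<sigma> q"; cases "\<sigma> t"; cases "\<sigma> (t + q)") simp_all
  then show ?case
    unfolding list.map foldr.simps comp_def sum_list.Cons Cons
      mult_smult_distrib[OF assms(1) assms(1)] mult smult_smult_mat
    by (simp only: p_def q_def)
qed

text \<open>As \<open>M\<close> is injective on \<open>X\<close>, every ordering of the matrices
  comes from an ordering of \<open>X\<close>. The sign in \<open>foldr_mult_twisted\<close> depends
  only on sums, and \<open>\<Sum>X = 0\<close> makes the remaining factor \<open>M 0\<close>, the
  identity.\<close>

lemma has_product_image:
  fixes M :: "'a :: comm_monoid_add \<Rightarrow> complex mat"
  assumes "\<And>t. M t \<in> carrier_mat (2 ^ N) (2 ^ N)" "M 0 = 1\<^sub>m (2 ^ N)" "\<sigma> 0 = 0"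
    and "\<And>s t. M s * M t = bit_sign (\<sigma> s + \<sigma> t + \<sigma> (s + t)) \<cdot>\<^sub>m M (s + t)"
    and X: "finite X" "inj_on M X" "\<Sum>X = 0"
  shows "has_product N (M ` X) (bit_sign (\<Sum>t\<in>X. \<sigma> t) \<cdot>\<^sub>m 1\<^sub>m (2 ^ N))"
  unfolding has_product_def
proof (intro conjI allI impI)
  fix Ms
  assume Ms: "distinct Ms \<and> set Ms = M ` X"
  define ts where "ts = map (inv_into X M) Ms"
  have "map M ts = Ms"
    unfolding ts_def map_map using Ms by (intro map_idI) (auto simp: f_inv_into_f)
  moreover have "set ts = X"
    using Ms X by (auto simp: ts_def image_image)
  moreover have "distinct ts"
    using Ms X by (auto simp: ts_def distinct_map inj_on_inv_into)
  ultimately have ts: "foldr (*) Ms (1\<^sub>m (2 ^ N)) = foldr (*) (map M ts) (1\<^sub>m (2 ^ N))"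
    "sum_list (map f ts) = sum f X" for f :: "'a \<Rightarrow> bit"
    by (auto simp: sum_list_distinct_conv_sum_set)
  have "sum_list ts = 0"
    using \<open>set ts = X\<close> \<open>distinct ts\<close> X sum_list_distinct_conv_sum_set[of ts "\<lambda>t. t"] by simp
  then show "foldr (*) Ms (1\<^sub>m (2 ^ N)) = bit_sign (\<Sum>t\<in>X. \<sigma> t) \<cdot>\<^sub>m 1\<^sub>m (2 ^ N)"
    unfolding ts foldr_mult_twisted[of M _ \<sigma>, OF assms(1-4)] using assms(2,3) by simp
qed (use X in simp)

text \<open>A finite set has at least one enumeration, so the quantification over all orders is
  never vacuous.\<close>

lemma has_product_unique:
  assumes "has_product N c P" "has_product N c Q"
  shows "P = Q"
  using assms finite_distinct_list[of c] unfolding has_product_def by metis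

section \<open>Coordinates on a plane\<close>

text \<open>The coordinate space F_2^3 is taken as nested pairs because these carry componentwise
  addition and can serve as the index monoid of \<open>has_product_image\<close>.\<close>

definition plane_point :: "bit vec \<Rightarrow> bit vec \<Rightarrow> bit vec \<Rightarrow> bit \<times> bit \<times> bit \<Rightarrow> bit vec" where
  "plane_point a b c t = fst t \<cdot>\<^sub>v a + fst (snd t) \<cdot>\<^sub>v b + snd (snd t) \<cdot>\<^sub>v c"

lemma plane_point_carrier [simp]:
  assumes "{a, b, c} \<subseteq> carrier_vec n"
  shows "plane_point a b c t \<in> carrier_vec n"
  using assms by (auto simp: plane_point_def)

lemma plane_point_index:
  assumes "{a, b, c} \<subseteq> carrier_vec n" "i < n"
  shows "plane_point a b c t $ i = fst t * a $ i + fst (snd t) * b $ i + snd (snd t) * c $ i"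
  using assms by (auto simp: plane_point_def)

lemma plane_point_zero:
  assumes "{a, b, c} \<subseteq> carrier_vec n"
  shows "plane_point a b c 0 = 0\<^sub>v n"
  using plane_point_index[OF assms] carrier_vecD[OF plane_point_carrier[OF assms]]
  by (intro eq_vecI) auto

lemma plane_point_add:
  assumes "{a, b, c} \<subseteq> carrier_vec n"
  shows "plane_point a b c (s + t) = plane_point a b c s + plane_point a b c t"
proof (rule eq_vecI)
  fix i
  assume "i < dim_vec (plane_point a b c s + plane_point a b c t)"
  then have i: "i < n"
    using carrier_vecD[OF plane_point_carrier[OF assms]] by simp
  then have "(plane_point a b c s + plane_point a b c t) $ i =
      plane_point a b c s $ i + plane_point a b c t $ i"
    using carrier_vecD[OF plane_point_carrier[OF assms]] by simp
  then show "plane_point a b c (s + t) $ i = (plane_point a b c s + plane_point a b c t) $ i"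
    by (simp only: plane_point_index[OF assms i] fst_add snd_add distrib_right add_ac)
qed (simp add: carrier_vecD[OF plane_point_carrier[OF assms]])

lemma UNIV_bit: "(UNIV :: bit set) = {0, 1}"
  by auto

lemma nonzero_bit_triples:
  "UNIV - {0 :: bit \<times> bit \<times> bit} =
    {(0, 0, 1), (0, 1, 0), (0, 1, 1), (1, 0, 0), (1, 0, 1), (1, 1, 0), (1, 1, 1)}"
  unfolding UNIV_Times_UNIV[symmetric] UNIV_bit by (auto simp: zero_prod_def)

lemma sum_nonzero_bit_triples:
  fixes f :: "bit \<times> bit \<times> bit \<Rightarrow> 'a :: comm_monoid_add"
  shows "sum f (UNIV - {0}) = f (0, 0, 1) + (f (0, 1, 0) + (f (0, 1, 1) + (f (1, 0, 0) +
    (f (1, 0, 1) + (f (1, 1, 0) + f (1, 1, 1))))))"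
  unfolding nonzero_bit_triples by simp

lemma finite_carrier_vec_bit: "finite (carrier_vec n :: bit vec set)"
proof -
  have "finite {xs :: bit list. set xs \<subseteq> UNIV \<and> length xs = n}"
    unfolding UNIV_bit by (rule finite_lists_length_eq) simp
  moreover have "carrier_vec n \<subseteq> vec_of_list ` {xs :: bit list. set xs \<subseteq> UNIV \<and> length xs = n}"
  proof
    fix v :: "bit vec"
    assume "v \<in> carrier_vec n"
    then have "v = vec_of_list (list_of_vec v)" "length (list_of_vec v) = n"
      by (auto simp: vec_list)
    then show "v \<in> vec_of_list ` {xs. set xs \<subseteq> UNIV \<and> length xs = n}"
      by auto
  qed
  ultimately show ?thesis
    by (rule finite_surj)
qed

text \<open>Projective dimension 2 is vector dimension 3, so a basis has three elements and its
  coordinate map is a bijection from F_2^3 onto the subspace, with 0 going to the vector that is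
  removed.\<close>

lemma totally_isotropic_plane:
  assumes "totally_isotropic N 2 S"
  obtains a b c where "{a, b, c} \<subseteq> carrier_vec (2 * N)" "inj (plane_point a b c)"
    "S = plane_point a b c ` (UNIV - {0})"
    "\<forall>x\<in>{a, b, c}. \<forall>y\<in>{a, b, c}. symplectic_form N x y = 0"
proof -
  let ?V = "module_vec TYPE(bit) (2 * N)"
  interpret V: vectorspace class_ring ?V
    by (rule vec_vs)
  obtain W where W: "VectorSpace.subspace class_ring W ?V"
    and dim: "vectorspace.dim class_ring (?V\<lparr>carrier := W\<rparr>) = 3"
    and iso: "\<And>x y. x \<in> W \<Longrightarrow> y \<in> W \<Longrightarrow> symplectic_form N x y = 0"
    and S: "S = W - {0\<^sub>v (2 * N)}"
    using assms by (auto simp: totally_isotropic_def)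
  interpret W: vectorspace class_ring "?V\<lparr>carrier := W\<rparr>"
    using V.subspace_is_vs[OF W] .
  have W_sub: "W \<subseteq> carrier_vec (2 * N)"
    using W unfolding VectorSpace.subspace_def submodule_def by (auto simp: module_vec_simps)
  then have "finite W"
    using finite_carrier_vec_bit finite_subset by blast
  \<comment> \<open>\<open>W\<close> is finite and spans itself.\<close>
  then have "W.fin_dim"
    unfolding W.fin_dim_def using W.in_own_span[of W] W.span_is_subset2[of W] by auto
  then obtain B where B: "finite B" "W.basis B"
    using W.finite_basis_exists by blast
  then have "card B = 3"
    using W.dim_basis dim by simp
  then obtain a b c where abc: "B = {a, b, c}" "a \<noteq> b" "a \<noteq> c" "b \<noteq> c"
    by (auto simp: card_3_iff)
  have B_sub: "B \<subseteq> W"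
    using B unfolding W.basis_def by auto
  then have carrier: "{a, b, c} \<subseteq> carrier_vec (2 * N)"
    using abc W_sub by auto
  have smult_W: "k \<cdot>\<^sub>v v \<in> W" if "v \<in> W" for k v
    using W.smult_closed[of k v] that by (simp add: module_vec_simps)
  have lincomb: "W.lincomb f B = plane_point a b c (f a, f b, f c)" for f
  proof -
    have "f c \<cdot>\<^sub>v c + 0\<^sub>v (2 * N) = f c \<cdot>\<^sub>v c"
      using carrier by auto
    then have "W.lincomb f B = f a \<cdot>\<^sub>v a + (f b \<cdot>\<^sub>v b + f c \<cdot>\<^sub>v c)"
      using abc B_sub smult_W
      by (simp add: W.lincomb_def W.finsum_insert W.finsum_empty Pi_iff module_vec_simps)
    then show ?thesis
      using carrier by (auto simp: plane_point_def)
  qed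
  \<comment> \<open>Since the basis vectors are distinct, every triple arises from a coefficient
    function.\<close>
  have coeff: "\<exists>f. (f a, f b, f c) = t" for t :: "bit \<times> bit \<times> bit"
    using abc
    by (intro exI[of _ "\<lambda>x. if x = a then fst t else if x = b then fst (snd t) else snd (snd t)"]) auto
  have "W = W.span B"
    using B unfolding W.basis_def by auto
  also have "\<dots> = range (plane_point a b c)"
  proof -
    have "W.span B = {W.lincomb f B | f. f \<in> B \<rightarrow> carrier class_ring}"
      using W.finite_span[OF B(1)] B_sub by simp
    also have "\<dots> = range (plane_point a b c)"
    proof (intro equalityI subsetI)
      fix v
      assume "v \<in> range (plane_point a b c)"
      then obtain t f where "v = plane_point a b c t" "(f a, f b, f c) = t"
        using coeff by blast
      then have "v = W.lincomb f B"
        by (simp add: lincomb)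
      then show "v \<in> {W.lincomb f B | f. f \<in> B \<rightarrow> carrier class_ring}"
        by auto
    qed (auto simp: lincomb)
    finally show ?thesis .
  qed
  finally have W_eq: "W = range (plane_point a b c)" .
  \<comment> \<open>A nonzero triple sent to zero would be a linear dependence of the basis.\<close>
  have kernel: "t = 0" if t: "plane_point a b c t = 0\<^sub>v (2 * N)" for t
  proof (rule ccontr)
    assume "t \<noteq> 0"
    obtain f where f: "(f a, f b, f c) = t"
      using coeff by blast
    with \<open>t \<noteq> 0\<close> have "\<not> (f a = 0 \<and> f b = 0 \<and> f c = 0)"
      by (auto simp: zero_prod_def)
    then obtain v where "v \<in> B" "f v \<noteq> 0"
      using abc(1) by blast
    moreover have "W.lincomb f B = 0\<^sub>v (2 * N)"
      using lincomb[of f] f t by simp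
    ultimately have "W.lin_dep B"
      unfolding W.lin_dep_def using B(1)
      by (intro exI[of _ B] exI[of _ f] exI[of _ v]) (auto simp: module_vec_simps)
    then show False
      using B unfolding W.basis_def by auto
  qed
  have inj: "inj (plane_point a b c)"
  proof (rule injI)
    fix s t
    assume "plane_point a b c s = plane_point a b c t"
    \<comment> \<open>In characteristic 2 the sum is also the difference, so the kernel decides
      injectivity.\<close>
    then have "plane_point a b c (s + t) = 0\<^sub>v (2 * N)"
      unfolding plane_point_add[OF carrier]
      using plane_point_carrier[OF carrier, of t] by (intro eq_vecI) auto
    then have "s + t = 0"
      by (rule kernel)
    then show "s = t"
      by (cases s; cases t) (auto simp: zero_prod_def)
  qed
  have "S = plane_point a b c ` (UNIV - {0})"
    unfolding S W_eq image_set_diff[OF inj] using plane_point_zero[OF carrier] by simp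
  moreover have "{a, b, c} \<subseteq> W"
    using B_sub abc(1) by simp
  then have "\<forall>x\<in>{a, b, c}. \<forall>y\<in>{a, b, c}. symplectic_form N x y = 0"
    using iso by blast
  ultimately show thesis
    by (rule that[OF carrier inj])
qed


section \<open>The sign of a plane\<close>

lemma half_form_plane_point:
  assumes "{a, b, c} \<subseteq> carrier_vec (2 * N)"
  shows "half_form N (plane_point a b c s) v =
      fst s * half_form N a v + fst (snd s) * half_form N b v + snd (snd s) * half_form N c v"
    and "half_form N v (plane_point a b c s) =
      fst s * half_form N v a + fst (snd s) * half_form N v b + snd (snd s) * half_form N v c"
  using assms unfolding plane_point_def
  by (simp_all only: half_form_bilinear smult_carrier_vec add_carrier_vec insert_subset)

text \<open>Orthogonality of the generators says that \<beta> is symmetric on them, and bilinearity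
  carries this symmetry to the whole plane.\<close>

lemma symplectic_form_plane_point:
  assumes "{a, b, c} \<subseteq> carrier_vec (2 * N)"
    and iso: "\<forall>x\<in>{a, b, c}. \<forall>y\<in>{a, b, c}. symplectic_form N x y = 0"
  shows "symplectic_form N (plane_point a b c s) (plane_point a b c t) = 0"
proof -
  have "half_form N y x = half_form N x y" if "x \<in> {a, b, c}" "y \<in> {a, b, c}" for x y
    using iso[rule_format, OF that] unfolding symplectic_form_eq
    by (cases "half_form N x y"; cases "half_form N y x") auto
  then have "half_form N b a = half_form N a b" "half_form N c a = half_form N a c"
    "half_form N c b = half_form N b c"
    by auto
  then have "half_form N (plane_point a b c s) (plane_point a b c t) =
    half_form N (plane_point a b c t) (plane_point a b c s)"
    unfolding half_form_plane_point[OF assms(1)]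
    by (simp only: distrib_left distrib_right mult_ac add_ac)
  then show ?thesis
    unfolding symplectic_form_eq by (cases "half_form N (plane_point a b c t) (plane_point a b c s)") auto
qed

text \<open>Idempotence and characteristic 2, each also in the form that applies inside a longer
  product or sum, so that sorted polynomials over F_2 can be cancelled by rewriting.\<close>

lemma bit_boolean_ring:
  fixes x y :: bit
  shows "x * x = x" "x * (x * y) = x * y" "x + x = 0" "x + (x + y) = y"
  by (cases x; cases y; simp)+

lemma has_product_plane:
  assumes carrier: "{a, b, c} \<subseteq> carrier_vec (2 * N)" and inj: "inj (plane_point a b c)"
    and iso: "\<forall>x\<in>{a, b, c}. \<forall>y\<in>{a, b, c}. symplectic_form N x y = 0"
  shows "has_product N (observable_of N ` plane_point a b c ` (UNIV - {0}))
    (bit_sign (\<Sum>t\<in>UNIV - {0}. y_half N (plane_point a b c t)) \<cdot>\<^sub>m 1\<^sub>m (2 ^ N))"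
proof -
  let ?P = "plane_point a b c"
  define g where "g x y = half_form N x y + half_form N x x * half_form N y y" for x y
  \<comment> \<open>On F_2^3 an alternating form is the polarization of the quadratic form whose
    mixed coefficients are its values on pairs of distinct basis vectors.\<close>
  define r where "r t = fst t * fst (snd t) * g a b + fst t * snd (snd t) * g a c +
    fst (snd t) * snd (snd t) * g b c" for t :: "bit \<times> bit \<times> bit"
  define \<sigma> where "\<sigma> t = y_half N (?P t) + r t" for t
  have sym: "half_form N y x = half_form N x y" if "x \<in> {a, b, c}" "y \<in> {a, b, c}" for x y
    using iso[rule_format, OF that] unfolding symplectic_form_eq
    by (cases "half_form N x y"; cases "half_form N y x") auto
  have swap: "half_form N b a = half_form N a b" "half_form N c a = half_form N a c"
    "half_form N c b = half_form N b c"
    by (rule sym; simp)+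
  \<comment> \<open>By \<open>swap\<close>, \<beta>(u, u) is additive on the plane and
    \<open>g\<close> is symmetric; its diagonal terms vanish because b + b * b = 0 in F_2. Only the
    mixed terms survive, and they are those of the polarization of \<open>r\<close>.\<close>
  have polar: "g (?P s) (?P t) = r s + r t + r (s + t)" for s t
    unfolding g_def r_def half_form_plane_point[OF carrier] swap fst_add snd_add
    by (simp only: distrib_left distrib_right mult_ac add_ac bit_boolean_ring add_0_left add_0_right)
  \<comment> \<open>Each product of two distinct coordinates is 1 at two of the seven points. On a
    line it would be 1 at a single point, so it matters here that the subspaces are planes.\<close>
  have r_sum: "(\<Sum>t\<in>UNIV - {0}. r t) = 0"
    unfolding sum_nonzero_bit_triples r_def
    by (cases "g a b"; cases "g a c"; cases "g b c") simp_all
  have "has_product N ((observable_of N \<circ> ?P) ` (UNIV - {0}))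
      (bit_sign (\<Sum>t\<in>UNIV - {0}. \<sigma> t) \<cdot>\<^sub>m 1\<^sub>m (2 ^ N))"
  proof (rule has_product_image)
    show "(observable_of N \<circ> ?P) s * (observable_of N \<circ> ?P) t =
        bit_sign (\<sigma> s + \<sigma> t + \<sigma> (s + t)) \<cdot>\<^sub>m (observable_of N \<circ> ?P) (s + t)" for s t
    proof -
      have "y_half N (?P s) + y_half N (?P t) + y_half N (?P (s + t)) + g (?P s) (?P t) =
          \<sigma> s + \<sigma> t + \<sigma> (s + t)"
        unfolding \<sigma>_def polar by (simp only: add_ac)
      then show ?thesis
        using observable_of_mult_isotropic[OF plane_point_carrier[OF carrier] plane_point_carrier[OF carrier]
            symplectic_form_plane_point[OF carrier iso], of s t]
        by (simp only: comp_def plane_point_add[OF carrier, symmetric] g_def add.assoc)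
    qed
    show "inj_on (observable_of N \<circ> ?P) (UNIV - {0})"
      using inj plane_point_carrier[OF carrier]
      by (intro comp_inj_on inj_on_subset[OF inj] inj_on_subset[OF observable_of_inj]) auto
    \<comment> \<open>Each coordinate is 1 at four of the seven nonzero triples.\<close>
    show "\<Sum>(UNIV - {0 :: bit \<times> bit \<times> bit}) = 0"
      unfolding sum_nonzero_bit_triples by (simp add: zero_prod_def)
    show "finite (UNIV - {0 :: bit \<times> bit \<times> bit})"
      unfolding nonzero_bit_triples by simp
    show "\<sigma> 0 = 0"
      by (simp add: \<sigma>_def r_def plane_point_zero[OF carrier] y_half_def y_count_def)
  qed (simp_all add: plane_point_zero[OF carrier] observable_of_zero)
  then show ?thesis
    by (simp only: \<sigma>_def sum.distrib r_sum add_0_right image_comp)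
qed

text \<open>Once r has dropped out, the sign is a sum over the points themselves and no longer
  refers to a basis.\<close>

lemma has_product_totally_isotropic:
  assumes "totally_isotropic N 2 S"
  shows "has_product N (observable_of N ` S) (bit_sign (\<Sum>w\<in>S. y_half N w) \<cdot>\<^sub>m 1\<^sub>m (2 ^ N))"
proof (rule totally_isotropic_plane[OF assms])
  fix a b c
  assume *: "{a, b, c} \<subseteq> carrier_vec (2 * N)" "inj (plane_point a b c)"
    "S = plane_point a b c ` (UNIV - {0})"
    "\<forall>x\<in>{a, b, c}. \<forall>y\<in>{a, b, c}. symplectic_form N x y = 0"
  have "(\<Sum>w\<in>S. y_half N w) = (\<Sum>t\<in>UNIV - {0}. y_half N (plane_point a b c t))"
    unfolding *(3) sum.reindex[OF inj_on_subset[OF *(2) subset_UNIV]] comp_def ..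
  then show "has_product N (observable_of N ` S) (bit_sign (\<Sum>w\<in>S. y_half N w) \<cdot>\<^sub>m 1\<^sub>m (2 ^ N))"
    using has_product_plane[OF *(1,2,4)] by (simp only: *(3))
qed

section \<open>The configuration of planes and the solution of its linear system\<close>

lemma minus_one_mat_neq: "- 1\<^sub>m (2 ^ N) \<noteq> (1\<^sub>m (2 ^ N) :: complex mat)"
proof
  assume "- 1\<^sub>m (2 ^ N) = (1\<^sub>m (2 ^ N) :: complex mat)"
  then have "(- 1\<^sub>m (2 ^ N)) $$ (0, 0) = (1\<^sub>m (2 ^ N) :: complex mat) $$ (0, 0)"
    by (rule arg_cong)
  then show False
    by simp
qed

lemma bit_sign_smult_one:
  "bit_sign b \<cdot>\<^sub>m 1\<^sub>m n = (if b = 0 then 1\<^sub>m n else - 1\<^sub>m n)"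
  by (cases b) auto

lemma totally_isotropic_subset:
  assumes "totally_isotropic N k S"
  shows "S \<subseteq> points N"
  using assms unfolding totally_isotropic_def points_def VectorSpace.subspace_def submodule_def
  by (auto simp: module_vec_simps)

lemma totally_isotropic_orthogonal:
  assumes "totally_isotropic N k S" "u \<in> S" "v \<in> S"
  shows "symplectic_form N u v = 0"
  using assms unfolding totally_isotropic_def by auto

lemma observable_of_pauli: "observable_of N u \<in> pauli_observables N"
  unfolding observable_of_def pauli_observables_def
  by (intro CollectI exI[of _ "map (\<lambda>j. pauli (u $ j) (u $ (j + N))) [0..<N]"]) (auto simp: pauli_def)

lemma quantum_configuration_planes: "quantum_configuration N (isotropic_configuration N 2)"
  unfolding isotropic_configuration_def quantum_configuration.simps
proof (intro conjI ballI)
  have sub: "c \<subseteq> observable_of N ` points N" if "c \<in> {observable_of N ` S | S. totally_isotropic N 2 S}" for c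
    using that totally_isotropic_subset by blast
  then show "c \<subseteq> observable_of N ` points N" if "c \<in> {observable_of N ` S | S. totally_isotropic N 2 S}" for c
    using that .
  show fin: "finite (observable_of N ` points N)"
    unfolding points_def using finite_carrier_vec_bit by blast
  show "finite {observable_of N ` S | S. totally_isotropic N 2 S}"
    by (rule finite_subset[of _ "Pow (observable_of N ` points N)"]) (use sub fin in auto)
  show "observable_of N ` points N \<subseteq> pauli_observables N"
    using observable_of_pauli by blast
  show "M * M = 1\<^sub>m (2 ^ N)" if "M \<in> observable_of N ` points N" for M
    using that observable_of_square by (auto simp: points_def)
next
  fix c A B
  assume "c \<in> {observable_of N ` S | S. totally_isotropic N 2 S}" "A \<in> c" "B \<in> c"
  then obtain S u v where "totally_isotropic N 2 S" "u \<in> S" "v \<in> S"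
    and AB: "A = observable_of N u" "B = observable_of N v"
    by blast
  moreover from this have "u \<in> carrier_vec (2 * N)" "v \<in> carrier_vec (2 * N)"
    using totally_isotropic_subset by (auto simp: points_def)
  \<comment> \<open>Orthogonality makes the commutation sign equal to 1.\<close>
  ultimately show "A * B = B * A"
    using observable_of_commute[of u N v] totally_isotropic_orthogonal[of N 2 S u v]
    by (simp add: one_smult_mat)
next
  fix c
  assume "c \<in> {observable_of N ` S | S. totally_isotropic N 2 S}"
  then obtain S where "totally_isotropic N 2 S" "c = observable_of N ` S"
    by blast
  then show "positive_context N c \<or> negative_context N c"
    using has_product_totally_isotropic[of N S]
    unfolding positive_context_def negative_context_def bit_sign_smult_one by (auto split: if_splits)
qed

text \<open>\<open>valuation\<close> only tests negativity, so when the sum is 0 the context must be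
  shown not to be negative as well; this follows from uniqueness of the product and from the
  identity differing from its negative.\<close>

lemma valuation_totally_isotropic:
  assumes "totally_isotropic N 2 S"
  shows "valuation N (observable_of N ` S) = (\<Sum>w\<in>S. y_half N w)"
proof (cases "(\<Sum>w\<in>S. y_half N w) = 0")
  case True
  then have "has_product N (observable_of N ` S) (1\<^sub>m (2 ^ N))"
    using has_product_totally_isotropic[OF assms] by (simp add: one_smult_mat)
  then have "\<not> negative_context N (observable_of N ` S)"
    unfolding negative_context_def using has_product_unique minus_one_mat_neq by blast
  with True show ?thesis
    by (simp add: valuation_def)
next
  case False
  then have "negative_context N (observable_of N ` S)"
    using has_product_totally_isotropic[OF assms]
    unfolding negative_context_def bit_sign_smult_one by simp
  with False show ?thesis
    by (simp add: valuation_def)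
qed

lemma non_contextual_planes: "\<not> contextual N (isotropic_configuration N 2)"
proof -
  \<comment> \<open>The solution is f, carried over to matrices by the inverse of the injective map
    \<open>observable_of\<close>.\<close>
  define x where "x M = y_half N (inv_into (carrier_vec (2 * N)) (observable_of N) M)" for M
  have "(\<Sum>M\<in>observable_of N ` points N. incidence (observable_of N ` S) M * x M) =
      valuation N (observable_of N ` S)" if S: "totally_isotropic N 2 S" for S
  proof -
    have sub: "S \<subseteq> points N" "S \<subseteq> carrier_vec (2 * N)"
      using totally_isotropic_subset[OF S] by (auto simp: points_def)
    have fin: "finite (observable_of N ` points N)"
      unfolding points_def using finite_carrier_vec_bit by blast
    \<comment> \<open>The incidence coefficients restrict the sum to the context, which is in
      bijection with \<open>S\<close>.\<close>
    have "(\<Sum>M\<in>observable_of N ` points N. incidence (observable_of N ` S) M * x M) =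
        (\<Sum>M\<in>observable_of N ` S. x M)"
      by (rule sum.mono_neutral_cong_right) (use fin sub in \<open>auto simp: incidence_def\<close>)
    also have "\<dots> = (\<Sum>w\<in>S. x (observable_of N w))"
      by (rule sum.reindex_cong[OF inj_on_subset[OF observable_of_inj sub(2)]]) auto
    also have "\<dots> = (\<Sum>w\<in>S. y_half N w)"
      unfolding x_def using sub by (intro sum.cong) (auto simp: inv_into_f_f[OF observable_of_inj])
    finally show ?thesis
      by (simp only: valuation_totally_isotropic[OF S])
  qed
  then show ?thesis
    unfolding isotropic_configuration_def contextual.simps by blast
qed

theorem mainTheorem5:
  fixes N :: nat
  assumes "N = 4 \<or> N = 5"
  shows "quantum_configuration N (isotropic_configuration N 2)
    \<and> \<not> contextual N (isotropic_configuration N 2)"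
  using quantum_configuration_planes non_contextual_planes by blast

end
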